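(* Let $\Lambda$ be a proper $\Lambda$-sequence. Then $C\Lambda BV_c$, with the norm $\|\cdot\|_\Lambda$, is separable.
   Context: A $\Lambda$-sequence is a nondecreasing sequence $\Lambda=(\lambda_k)_{k\ge 1}$ of positive reals with $\sum_k \frac{1}{\lambda_k}=\infty$; it is proper if $\lambda_k\to\infty$. For a closed interval $I=[a,b]\subseteq[0,1]$ and $f:[0,1]\to\mathbb{R}$ write $|f(I)|=|f(b)-f(a)|$. Closed intervals are nonoverlapping if any two of them intersect at most at endpoints. For a finite sequence $\mathcal{I}=\langle I_1,\dots,I_m\rangle$ (in any order) of nonoverlapping closed intervals contained in $[0,1]$ put $\sigma_\Lambda(f,\mathcal{I})=\sum_{k=1}^m\frac{|f(I_k)|}{\lambda_k}$. The $\Lambda$-variation of $f$ is $V_\Lambda(f)=\sup_{\mathcal{I}}\sigma_\Lambda(f,\mathcal{I})\in[0,\infty]$, the supremum being over all such finite sequences. $\Lambda BV$ is the linear space of all $f:[0,1]\to\mathbb{R}$ with $V_\Lambda(f)<\infty$, normed by $\|f\|_\Lambda=V_\Lambda(f)+|f(0)|$. For $m\ge 1$, $\Lambda_{(m)}=(\lambda_{m+1},\lambda_{m+2},\dots)$. A function $f\in\Lambda BV$ is continuous in $\Lambda$-variation if $\lim_{m\to\infty}V_{\Lambda_{(m)}}(f)=0$. $C\Lambda BV_c$ is the set of all continuous functions $f:[0,1]\to\mathbb{R}$ that are continuous in $\Lambda$-variation. *)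

theory Defs
  imports "HOL-Analysis.Analysis"
begin

text \<open>Sequences are indexed from 0: \<open>L k\<close> is the term \<open>\<lambda>\<^sub>k\<^sub>+\<^sub>1\<close> of \<open>\<Lambda>\<close>.\<close>

definition Lambda_sequence :: "(nat \<Rightarrow> real) \<Rightarrow> bool" where
  "Lambda_sequence L \<longleftrightarrow> mono L \<and> (\<forall>k. 0 < L k) \<and> (\<Sum>k. ennreal (1 / L k)) = \<infinity>"

definition proper_Lambda_sequence :: "(nat \<Rightarrow> real) \<Rightarrow> bool" where
  "proper_Lambda_sequence L \<longleftrightarrow> Lambda_sequence L \<and> filterlim L at_top sequentially"

definition tail_seq :: "nat \<Rightarrow> (nat \<Rightarrow> real) \<Rightarrow> nat \<Rightarrow> real" where
  "tail_seq m L = (\<lambda>k. L (m + k))"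

text \<open>
  A pair \<open>(a, b)\<close> stands for the closed interval \<open>{a..b}\<close>. Degenerate intervals and the empty
  sequence are admitted; they contribute nothing to the sums, so the suprema below do not
  depend on this.
\<close>

definition nonoverlapping :: "real \<times> real \<Rightarrow> real \<times> real \<Rightarrow> bool" where
  "nonoverlapping I J \<longleftrightarrow>
     {fst I..snd I} \<inter> {fst J..snd J} \<subseteq> {fst I, snd I} \<inter> {fst J, snd J}"

definition interval_seqs :: "(real \<times> real) list set" where
  "interval_seqs = {Is.
     (\<forall>I\<in>set Is. 0 \<le> fst I \<and> fst I \<le> snd I \<and> snd I \<le> 1) \<and>
     (\<forall>i<length Is. \<forall>j<length Is. i \<noteq> j \<longrightarrow> nonoverlapping (Is ! i) (Is ! j))}"

definition var_sum :: "(nat \<Rightarrow> real) \<Rightarrow> (real \<Rightarrow> real) \<Rightarrow> (real \<times> real) list \<Rightarrow> real" where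
  "var_sum L f Is = (\<Sum>k<length Is. \<bar>f (snd (Is ! k)) - f (fst (Is ! k))\<bar> / L k)"

definition Lambda_variation :: "(nat \<Rightarrow> real) \<Rightarrow> (real \<Rightarrow> real) \<Rightarrow> ennreal" where
  "Lambda_variation L f = (SUP Is\<in>interval_seqs. ennreal (var_sum L f Is))"

text \<open>
  A function on \<open>[0,1]\<close> is represented by the total function that extends it by the value
  \<open>undefined\<close> outside \<open>{0..1}\<close>, so that equality of representatives is equality on \<open>[0,1]\<close>.
  The variation and the norm only look at values on \<open>{0..1}\<close>; hence \<open>\<lambda>x. f x - g x\<close> below need not
  be restricted.
\<close>

definition Lambda_BV :: "(nat \<Rightarrow> real) \<Rightarrow> (real \<Rightarrow> real) set" where
  "Lambda_BV L = {f \<in> extensional {0..1}. Lambda_variation L f < \<infinity>}"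

definition Lambda_norm :: "(nat \<Rightarrow> real) \<Rightarrow> (real \<Rightarrow> real) \<Rightarrow> real" where
  "Lambda_norm L f = enn2real (Lambda_variation L f) + \<bar>f 0\<bar>"

definition continuous_in_Lambda_variation :: "(nat \<Rightarrow> real) \<Rightarrow> (real \<Rightarrow> real) \<Rightarrow> bool" where
  "continuous_in_Lambda_variation L f \<longleftrightarrow>
     f \<in> Lambda_BV L \<and> (\<lambda>m. Lambda_variation (tail_seq m L) f) \<longlonglongrightarrow> 0"

definition C_Lambda_BV_c :: "(nat \<Rightarrow> real) \<Rightarrow> (real \<Rightarrow> real) set" where
  "C_Lambda_BV_c L = {f. continuous_on {0..1} f \<and> continuous_in_Lambda_variation L f}"

definition Lambda_dist :: "(nat \<Rightarrow> real) \<Rightarrow> (real \<Rightarrow> real) \<Rightarrow> (real \<Rightarrow> real) \<Rightarrow> real" where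
  "Lambda_dist L f g = Lambda_norm L (\<lambda>x. f x - g x)"

definition Lambda_topology :: "(nat \<Rightarrow> real) \<Rightarrow> (real \<Rightarrow> real) topology" where
  "Lambda_topology L = Metric_space.mtopology (C_Lambda_BV_c L) (Lambda_dist L)"

text \<open>
  The locale constant \<open>Metric_space.mtopology\<close> is only meaningful for a metric; the rest of this
  theory shows that \<open>Lambda_dist L\<close> is one.
\<close>

lemma var_sum_nonneg:
  assumes "\<And>k. 0 < L k"
  shows "0 \<le> var_sum L f Is"
  unfolding var_sum_def by (intro sum_nonneg divide_nonneg_pos assms) auto

lemma Lambda_variation_upper:
  "Is \<in> interval_seqs \<Longrightarrow> ennreal (var_sum L f Is) \<le> Lambda_variation L f"
  unfolding Lambda_variation_def by (rule SUP_upper)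

lemma Lambda_variation_le_add:
  assumes "\<And>k. 0 < L k"
    and "\<And>a b. \<bar>h b - h a\<bar> \<le> \<bar>f b - f a\<bar> + \<bar>g b - g a\<bar>"
  shows "Lambda_variation L h \<le> Lambda_variation L f + Lambda_variation L g"
  unfolding Lambda_variation_def[of L h]
proof (rule SUP_least)
  fix Is assume Is: "Is \<in> interval_seqs"
  have "var_sum L h Is \<le> var_sum L f Is + var_sum L g Is"
    unfolding var_sum_def sum.distrib[symmetric]
  proof (rule sum_mono)
    fix k
    show "\<bar>h (snd (Is ! k)) - h (fst (Is ! k))\<bar> / L k
        \<le> \<bar>f (snd (Is ! k)) - f (fst (Is ! k))\<bar> / L k + \<bar>g (snd (Is ! k)) - g (fst (Is ! k))\<bar> / L k"
      using divide_right_mono[OF assms(2) less_imp_le[OF assms(1)]]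
      by (simp add: add_divide_distrib)
  qed
  then have "ennreal (var_sum L h Is) \<le> ennreal (var_sum L f Is) + ennreal (var_sum L g Is)"
    by (simp add: ennreal_leI var_sum_nonneg assms(1) flip: ennreal_plus)
  also have "\<dots> \<le> Lambda_variation L f + Lambda_variation L g"
    by (intro add_mono Lambda_variation_upper Is)
  finally show "ennreal (var_sum L h Is) \<le> Lambda_variation L f + Lambda_variation L g" .
qed

lemma Lambda_variation_diff_finite:
  assumes "\<And>k. 0 < L k" "f \<in> Lambda_BV L" "g \<in> Lambda_BV L"
  shows "Lambda_variation L (\<lambda>x. f x - g x) < \<infinity>"
proof -
  have "Lambda_variation L (\<lambda>x. f x - g x) \<le> Lambda_variation L f + Lambda_variation L g"
    by (rule Lambda_variation_le_add[OF assms(1)]) linarith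
  also have "\<dots> < \<infinity>"
    using assms by (simp add: Lambda_BV_def)
  finally show ?thesis .
qed

lemma Lambda_variation_eq_0:
  assumes pos: "\<And>k. 0 < L k" and "Lambda_variation L f = 0" and x: "x \<in> {0..1}"
  shows "f x = f 0"
proof -
  have "[(0, x)] \<in> interval_seqs"
    using x by (auto simp: interval_seqs_def)
  from Lambda_variation_upper[OF this, of L f]
  have "var_sum L f [(0, x)] \<le> 0"
    using assms(2) by (simp add: ennreal_eq_0_iff)
  then show ?thesis
    using pos[of 0] by (simp add: var_sum_def divide_le_0_iff)
qed

lemma Metric_space_Lambda_BV:
  assumes pos: "\<And>k. 0 < L k"
  shows "Metric_space (Lambda_BV L) (Lambda_dist L)"
proof
  fix f g :: "real \<Rightarrow> real"
  show "0 \<le> Lambda_dist L f g"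
    by (simp add: Lambda_dist_def Lambda_norm_def)
  have "\<bar>f b - g b - (f a - g a)\<bar> = \<bar>g b - f b - (g a - f a)\<bar>" for a b
    by linarith
  then have "var_sum L (\<lambda>x. f x - g x) Is = var_sum L (\<lambda>x. g x - f x) Is" for Is
    by (simp only: var_sum_def)
  then show "Lambda_dist L f g = Lambda_dist L g f"
    by (simp add: Lambda_dist_def Lambda_norm_def Lambda_variation_def abs_minus_commute)
next
  fix f g assume f: "f \<in> Lambda_BV L" and g: "g \<in> Lambda_BV L"
  note fin = Lambda_variation_diff_finite[OF pos f g]
  show "Lambda_dist L f g = 0 \<longleftrightarrow> f = g"
  proof
    assume *: "Lambda_dist L f g = 0"
    have "enn2real (Lambda_variation L (\<lambda>x. f x - g x)) = 0" and 0: "f 0 = g 0"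
      using * enn2real_nonneg[of "Lambda_variation L (\<lambda>x. f x - g x)"]
      unfolding Lambda_dist_def Lambda_norm_def by linarith+
    then have V: "Lambda_variation L (\<lambda>x. f x - g x) = 0"
      using fin by (auto simp: enn2real_eq_0_iff)
    show "f = g"
    proof (rule extensionalityI)
      show "f \<in> extensional {0..1}" "g \<in> extensional {0..1}"
        using f g by (auto simp: Lambda_BV_def)
      fix x :: real assume "x \<in> {0..1}"
      from Lambda_variation_eq_0[OF pos V this] show "f x = g x"
        using 0 by simp
    qed
  next
    assume "f = g"
    then have "Lambda_variation L (\<lambda>x. f x - g x) \<le> 0"
      unfolding Lambda_variation_def by (intro SUP_least) (simp add: var_sum_def)
    then show "Lambda_dist L f g = 0"
      using \<open>f = g\<close> by (simp add: Lambda_dist_def Lambda_norm_def)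
  qed
next
  fix f g h assume f: "f \<in> Lambda_BV L" and g: "g \<in> Lambda_BV L" and h: "h \<in> Lambda_BV L"
  let ?V = "\<lambda>u v. Lambda_variation L (\<lambda>x. u x - v x)"
  note fin = Lambda_variation_diff_finite[OF pos f g] Lambda_variation_diff_finite[OF pos g h]
  have "?V f h \<le> ?V f g + ?V g h"
    by (rule Lambda_variation_le_add[OF pos]) linarith
  then have "enn2real (?V f h) \<le> enn2real (?V f g + ?V g h)"
    using fin by (intro enn2real_mono) auto
  also have "\<dots> = enn2real (?V f g) + enn2real (?V g h)"
    using fin by (intro enn2real_plus) auto
  finally show "Lambda_dist L f h \<le> Lambda_dist L f g + Lambda_dist L g h"
    unfolding Lambda_dist_def Lambda_norm_def by linarith
qed

lemma Metric_space_C_Lambda_BV_c: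
  assumes "Lambda_sequence L"
  shows "Metric_space (C_Lambda_BV_c L) (Lambda_dist L)"
proof (rule Metric_space.subspace[OF Metric_space_Lambda_BV])
  show "C_Lambda_BV_c L \<subseteq> Lambda_BV L"
    by (auto simp: C_Lambda_BV_c_def continuous_in_Lambda_variation_def)
qed (use assms in \<open>simp add: Lambda_sequence_def\<close>)

end

theory Submission
  imports Defs "HOL-Probability.Probability_Measure"
begin

text \<open>
  The countable dense set consists of the piecewise linear functions on the grids \<open>j / n\<close> with
  rational values at the nodes. Two approximations are composed: a function \<open>f\<close> of the space by its
  piecewise linear interpolant \<open>p\<^sub>n\<close>, and that interpolant by one with rational nodes. The second
  is harmless, since on a fixed grid the Lipschitz constant, and with it the \<open>\<Lambda>\<close>-variation, is
  controlled by the node values.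

  For the first, the heart of the matter is that interpolation does not increase the variation
  for any weight sequence (\<open>Lambda_variation_interpolant_le\<close>). This is because interpolation is
  averaged rounding: if \<open>u\<close> is uniform on \<open>[0,1)\<close>, then \<open>\<lfloor>nx + u\<rfloor>\<close> is one of the two integers next
  to \<open>nx\<close>, with exactly the probabilities that make \<open>p\<^sub>n(x)\<close> the mean of \<open>f(\<lfloor>nx + u\<rfloor> / n)\<close>
  (\<open>interpolant_eq_integral\<close>). For each fixed \<open>u\<close> the rounding is monotone in \<open>x\<close>, so it maps a
  sequence of nonoverlapping intervals to another one, and the variation sum of \<open>p\<^sub>n\<close> is at most
  an average of variation sums of \<open>f\<close>.

  Now split a variation sum of \<open>f - p\<^sub>n\<close> after its first \<open>m\<close> terms. The rest is at most
  \<open>2 V(f)\<close> for the tail \<open>\<Lambda>\<^sub>(\<^sub>m\<^sub>)\<close>, uniformly in \<open>n\<close>; by continuity in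
  \<open>\<Lambda>\<close>-variation this is small for a suitable \<open>m\<close>. With \<open>m\<close> fixed, the first \<open>m\<close> terms are
  controlled by the supremum of \<open>\<bar>f - p\<^sub>n\<bar>\<close>, which tends to \<open>0\<close> by uniform continuity.

  Properness of \<open>\<Lambda>\<close> puts the piecewise linear functions into the space: a Lipschitz function with
  constant \<open>K\<close> has variation at most \<open>K / \<lambda>\<^sub>m\<^sub>+\<^sub>1\<close> for the tail \<open>\<Lambda>\<^sub>(\<^sub>m\<^sub>)\<close>.
\<close>

section \<open>Nonoverlapping intervals\<close>

text \<open>
  In terms of order, nonoverlap becomes a condition that monotone maps preserve. It also holds for
  degenerate intervals: a point in the interior of another interval counts as an overlap.
\<close>

lemma nonoverlapping_iff:
  assumes "fst I \<le> snd I" "fst J \<le> snd J"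
  shows "nonoverlapping I J \<longleftrightarrow> snd I \<le> fst J \<or> snd J \<le> fst I"
proof
  assume no: "nonoverlapping I J"
  show "snd I \<le> fst J \<or> snd J \<le> fst I"
  proof (rule ccontr)
    assume "\<not> ?thesis"
    then have lt: "fst J < snd I" "fst I < snd J" by auto
    \<comment> \<open>The midpoint of the intersection lies in both intervals, but it is not an endpoint of both.\<close>
    define z where "z = (max (fst I) (fst J) + min (snd I) (snd J)) / 2"
    have "z \<in> {fst I..snd I} \<inter> {fst J..snd J}"
      using lt assms unfolding z_def by auto
    then have "z \<in> {fst I, snd I} \<inter> {fst J, snd J}"
      using no unfolding nonoverlapping_def by blast
    then show False
      using lt assms unfolding z_def by (auto simp: max_def min_def split: if_splits)
  qed
qed (use assms in \<open>auto simp: nonoverlapping_def\<close>)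

lemma interval_seqs_mono_image:
  assumes Is: "Is \<in> interval_seqs"
    and into: "\<phi> \<in> {0..1} \<rightarrow> {0..1}" and mono: "mono_on {0..1} \<phi>"
  shows "map (map_prod \<phi> \<phi>) Is \<in> interval_seqs"
proof -
  have unit: "0 \<le> fst I \<and> fst I \<le> snd I \<and> snd I \<le> 1" if "I \<in> set Is" for I
    using Is that by (auto simp: interval_seqs_def)
  have ord: "\<phi> x \<le> \<phi> y" if "0 \<le> x" "x \<le> y" "y \<le> 1" for x y
    using mono that by (auto simp: mono_on_def)
  have img: "0 \<le> \<phi> (fst I) \<and> \<phi> (fst I) \<le> \<phi> (snd I) \<and> \<phi> (snd I) \<le> 1" if "I \<in> set Is" for I
    using unit[OF that] into ord[of "fst I" "snd I"]
    by (auto simp: Pi_iff)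
  have "nonoverlapping (map_prod \<phi> \<phi> (Is ! i)) (map_prod \<phi> \<phi> (Is ! j))"
    if ij: "i < length Is" "j < length Is" "i \<noteq> j" for i j
  proof -
    have "nonoverlapping (Is ! i) (Is ! j)"
      using Is ij by (auto simp: interval_seqs_def)
    then have "snd (Is ! i) \<le> fst (Is ! j) \<or> snd (Is ! j) \<le> fst (Is ! i)"
      using nonoverlapping_iff unit ij by auto
    then have "\<phi> (snd (Is ! i)) \<le> \<phi> (fst (Is ! j)) \<or> \<phi> (snd (Is ! j)) \<le> \<phi> (fst (Is ! i))"
      using unit[of "Is ! i"] unit[of "Is ! j"] ij ord[of "snd (Is ! i)" "fst (Is ! j)"]
        ord[of "snd (Is ! j)" "fst (Is ! i)"] by auto
    then show ?thesis
      using nonoverlapping_iff[of "map_prod \<phi> \<phi> (Is ! i)" "map_prod \<phi> \<phi> (Is ! j)"]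
        img[of "Is ! i"] img[of "Is ! j"] ij by auto
  qed
  with img show ?thesis
    by (auto simp: interval_seqs_def)
qed

lemma interval_seqs_nth:
  assumes "Is \<in> interval_seqs" "k < length Is"
  shows "fst (Is ! k) \<in> {0..1}" "snd (Is ! k) \<in> {0..1}" "fst (Is ! k) \<le> snd (Is ! k)"
proof -
  have "Is ! k \<in> set Is" using assms by simp
  then have "0 \<le> fst (Is ! k) \<and> fst (Is ! k) \<le> snd (Is ! k) \<and> snd (Is ! k) \<le> 1"
    using assms(1) unfolding interval_seqs_def by blast
  then show "fst (Is ! k) \<in> {0..1}" "snd (Is ! k) \<in> {0..1}" "fst (Is ! k) \<le> snd (Is ! k)"
    by auto
qed

lemma interval_seqs_drop: "Is \<in> interval_seqs \<Longrightarrow> drop m Is \<in> interval_seqs"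
  unfolding interval_seqs_def by (auto dest: in_set_dropD)

text \<open>Additivity of Lebesgue measure: the interiors are disjoint subsets of the unit interval.\<close>

lemma interval_seqs_total_length:
  assumes Is: "Is \<in> interval_seqs"
  shows "(\<Sum>k<length Is. snd (Is ! k) - fst (Is ! k)) \<le> 1"
proof -
  let ?A = "\<lambda>k. {fst (Is ! k)<..<snd (Is ! k)}"
  note Is_nth = interval_seqs_nth[OF Is]
  have disj: "disjoint_family_on ?A {..<length Is}"
  proof (unfold disjoint_family_on_def, intro ballI impI)
    fix i j assume ij: "i \<in> {..<length Is}" "j \<in> {..<length Is}" "i \<noteq> j"
    then have "nonoverlapping (Is ! i) (Is ! j)"
      using Is by (auto simp: interval_seqs_def)
    then have "snd (Is ! i) \<le> fst (Is ! j) \<or> snd (Is ! j) \<le> fst (Is ! i)"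
      using nonoverlapping_iff Is_nth(3) ij by auto
    then show "?A i \<inter> ?A j = {}" by auto
  qed
  have "(\<Sum>k<length Is. snd (Is ! k) - fst (Is ! k)) = (\<Sum>k<length Is. measure lborel (?A k))"
    using Is_nth(3) by (intro sum.cong) auto
  also have "\<dots> = measure lborel (\<Union>k<length Is. ?A k)"
    using disj Is_nth(3) by (intro measure_finite_Union[symmetric]) auto
  also have "\<dots> \<le> measure lborel {0..1::real}"
  proof (rule measure_mono_fmeasurable)
    show "(\<Union>k<length Is. ?A k) \<subseteq> {0..1}"
      using Is_nth(1,2) by fastforce
  qed (auto simp: fmeasurable_def)
  finally show ?thesis by simp
qed

section \<open>Estimates for the variation\<close>

lemma var_sum_cong:
  assumes "Is \<in> interval_seqs" "\<And>x. x \<in> {0..1} \<Longrightarrow> f x = g x"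
  shows "var_sum L f Is = var_sum L g Is"
  unfolding var_sum_def using interval_seqs_nth[OF assms(1)] assms(2)
  by (intro sum.cong) auto

lemma Lambda_variation_cong:
  assumes "\<And>x. x \<in> {0..1} \<Longrightarrow> f x = g x"
  shows "Lambda_variation L f = Lambda_variation L g"
  unfolding Lambda_variation_def using var_sum_cong[OF _ assms] by (intro SUP_cong) auto

text \<open>
  All weights \<open>1 / L k\<close> are at most \<open>1 / L 0\<close>, and the increments are at most \<open>K\<close> times the lengths
  of the intervals, which add up to at most \<open>1\<close>.
\<close>

lemma Lambda_variation_lipschitz_le:
  assumes L: "mono L" "\<And>k. 0 < L k" and K: "0 \<le> K"
    and lip: "\<And>x y. x \<in> {0..1} \<Longrightarrow> y \<in> {0..1} \<Longrightarrow> \<bar>g y - g x\<bar> \<le> K * \<bar>y - x\<bar>"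
  shows "Lambda_variation L g \<le> ennreal (K / L 0)"
  unfolding Lambda_variation_def
proof (intro SUP_least ennreal_leI)
  fix Is assume Is: "Is \<in> interval_seqs"
  note Is_nth = interval_seqs_nth[OF Is]
  have "var_sum L g Is \<le> (\<Sum>k<length Is. K * (snd (Is ! k) - fst (Is ! k)) / L 0)"
    unfolding var_sum_def
  proof (rule sum_mono)
    fix k assume "k \<in> {..<length Is}"
    then have "\<bar>g (snd (Is ! k)) - g (fst (Is ! k))\<bar> \<le> K * (snd (Is ! k) - fst (Is ! k))"
      using lip[of "fst (Is ! k)" "snd (Is ! k)"] Is_nth[of k] by auto
    then show "\<bar>g (snd (Is ! k)) - g (fst (Is ! k))\<bar> / L k \<le> K * (snd (Is ! k) - fst (Is ! k)) / L 0"
      using L monoD[OF L(1), of 0 k] by (intro frac_le) auto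
  qed
  also have "\<dots> = K / L 0 * (\<Sum>k<length Is. snd (Is ! k) - fst (Is ! k))"
    by (simp add: sum_distrib_left)
  also have "\<dots> \<le> K / L 0 * 1"
    using K L(2)[of 0] by (intro mult_left_mono interval_seqs_total_length[OF Is]) auto
  finally show "var_sum L g Is \<le> K / L 0" by simp
qed

text \<open>
  The first \<open>m\<close> increments are bounded by \<open>2 * \<eta>\<close> each; what remains is a variation sum for the
  tail of the weights. This makes uniform convergence sufficient as soon as the tails are
  uniformly small.
\<close>

lemma Lambda_variation_le_sup_plus_tail:
  assumes L: "\<And>k. 0 < L k" and h: "\<And>x. x \<in> {0..1} \<Longrightarrow> \<bar>h x\<bar> \<le> \<eta>"
  shows "Lambda_variation L h
           \<le> ennreal (2 * \<eta> * (\<Sum>k<m. 1 / L k)) + Lambda_variation (tail_seq m L) h"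
  unfolding Lambda_variation_def[of L]
proof (rule SUP_least)
  fix Is assume Is: "Is \<in> interval_seqs"
  note Is_nth = interval_seqs_nth[OF Is]
  have \<eta>: "0 \<le> \<eta>" using h[of 0] by simp
  let ?t = "\<lambda>k. \<bar>h (snd (Is ! k)) - h (fst (Is ! k))\<bar> / L k"
  let ?l = "length Is"
  have head: "(\<Sum>k<min m ?l. ?t k) \<le> 2 * \<eta> * (\<Sum>k<m. 1 / L k)"
  proof -
    have "(\<Sum>k<min m ?l. ?t k) \<le> (\<Sum>k<min m ?l. 2 * \<eta> * (1 / L k))"
    proof (rule sum_mono)
      fix k assume "k \<in> {..<min m ?l}"
      then have "\<bar>h (snd (Is ! k)) - h (fst (Is ! k))\<bar> \<le> 2 * \<eta>"
        using h[of "fst (Is ! k)"] h[of "snd (Is ! k)"] Is_nth[of k] by force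
      then show "?t k \<le> 2 * \<eta> * (1 / L k)"
        using L[of k] by (simp add: divide_right_mono)
    qed
    also have "\<dots> \<le> (\<Sum>k<m. 2 * \<eta> * (1 / L k))"
      using \<eta> L by (intro sum_mono2) (auto simp: less_imp_le)
    finally show ?thesis by (simp add: sum_distrib_left)
  qed
  have tail: "(\<Sum>k\<in>{m..<?l}. ?t k) = var_sum (tail_seq m L) h (drop m Is)"
    unfolding var_sum_def tail_seq_def
    by (rule sum.reindex_bij_witness[of _ "\<lambda>k. m + k" "\<lambda>k. k - m"]) auto
  have "var_sum L h Is = (\<Sum>k<min m ?l. ?t k) + (\<Sum>k\<in>{m..<?l}. ?t k)"
    unfolding var_sum_def by (subst sum.union_disjoint[symmetric]) (auto intro: sum.cong)
  also have "\<dots> \<le> 2 * \<eta> * (\<Sum>k<m. 1 / L k) + var_sum (tail_seq m L) h (drop m Is)"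
    using head tail by simp
  finally have "ennreal (var_sum L h Is)
      \<le> ennreal (2 * \<eta> * (\<Sum>k<m. 1 / L k) + var_sum (tail_seq m L) h (drop m Is))"
    by (rule ennreal_leI)
  also have "\<dots> = ennreal (2 * \<eta> * (\<Sum>k<m. 1 / L k)) + ennreal (var_sum (tail_seq m L) h (drop m Is))"
    using L \<eta>
    by (intro ennreal_plus var_sum_nonneg mult_nonneg_nonneg sum_nonneg)
       (auto simp: tail_seq_def less_imp_le)
  also have "\<dots> \<le> ennreal (2 * \<eta> * (\<Sum>k<m. 1 / L k)) + Lambda_variation (tail_seq m L) h"
    by (intro add_left_mono Lambda_variation_upper interval_seqs_drop Is)
  finally show "ennreal (var_sum L h Is) \<le> \<dots>" .
qed

section \<open>Broken lines\<close>

text \<open>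
  For \<open>n > 0\<close> this is, on the unit interval, the piecewise linear function with the value \<open>c j\<close> at
  each node \<open>j / n\<close>, written in the basis of hat functions. In this form it is linear in \<open>c\<close>, and
  the hat functions reappear below as rounding probabilities.
\<close>

definition broken_line :: "nat \<Rightarrow> (nat \<Rightarrow> real) \<Rightarrow> real \<Rightarrow> real" where
  "broken_line n c x = (\<Sum>j\<le>n. c j * max 0 (1 - \<bar>real n * x - real j\<bar>))"

lemma broken_line_diff: "broken_line n c x - broken_line n d x = broken_line n (\<lambda>j. c j - d j) x"
  by (simp add: broken_line_def sum_subtractf[symmetric] algebra_simps)

lemma abs_broken_line_le: "\<bar>broken_line n c x\<bar> \<le> (\<Sum>j\<le>n. \<bar>c j\<bar>)"
proof -
  have "\<bar>broken_line n c x\<bar> \<le> (\<Sum>j\<le>n. \<bar>c j * max 0 (1 - \<bar>real n * x - real j\<bar>)\<bar>)"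
    unfolding broken_line_def by (rule sum_abs)
  also have "\<dots> \<le> (\<Sum>j\<le>n. \<bar>c j\<bar>)"
    by (intro sum_mono) (auto simp: abs_mult intro!: mult_left_le)
  finally show ?thesis .
qed

lemma broken_line_lipschitz:
  "\<bar>broken_line n c y - broken_line n c x\<bar> \<le> real n * (\<Sum>j\<le>n. \<bar>c j\<bar>) * \<bar>y - x\<bar>"
proof -
  let ?h = "\<lambda>j x. max 0 (1 - \<bar>real n * x - real j\<bar>)"
  have "\<bar>broken_line n c y - broken_line n c x\<bar> = \<bar>\<Sum>j\<le>n. c j * (?h j y - ?h j x)\<bar>"
    by (simp add: broken_line_def sum_subtractf[symmetric] algebra_simps)
  also have "\<dots> \<le> (\<Sum>j\<le>n. \<bar>c j * (?h j y - ?h j x)\<bar>)" by (rule sum_abs)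
  also have "\<dots> \<le> (\<Sum>j\<le>n. \<bar>c j\<bar> * (real n * \<bar>y - x\<bar>))"
  proof (rule sum_mono)
    fix j
    have "\<bar>?h j y - ?h j x\<bar> \<le> \<bar>real n * y - real n * x\<bar>" by linarith
    also have "\<dots> = real n * \<bar>y - x\<bar>"
      by (simp add: right_diff_distrib[symmetric] abs_mult)
    finally show "\<bar>c j * (?h j y - ?h j x)\<bar> \<le> \<bar>c j\<bar> * (real n * \<bar>y - x\<bar>)"
      by (simp add: abs_mult mult_left_mono)
  qed
  finally show ?thesis by (simp add: sum_distrib_right sum_distrib_left mult_ac)
qed

lemma continuous_on_broken_line: "continuous_on A (broken_line n c)"
  unfolding broken_line_def by (intro continuous_intros)

lemma Lambda_variation_broken_line_le:
  assumes L: "mono L" "\<And>k. 0 < L k"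
  shows "Lambda_variation L (broken_line n c) \<le> ennreal (real n * (\<Sum>j\<le>n. \<bar>c j\<bar>) / L 0)"
  by (intro Lambda_variation_lipschitz_le broken_line_lipschitz L mult_nonneg_nonneg sum_nonneg) auto

text \<open>
  The bound for Lipschitz functions, applied to the tail that starts at \<open>L m\<close>, decays like
  \<open>1 / L m\<close>; this is where properness enters.
\<close>

lemma restrict_broken_line_in_C_Lambda_BV_c:
  assumes "proper_Lambda_sequence L"
  shows "restrict (broken_line n c) {0..1} \<in> C_Lambda_BV_c L"
proof -
  let ?g = "restrict (broken_line n c) {0..1}"
  let ?K = "real n * (\<Sum>j\<le>n. \<bar>c j\<bar>)"
  have L: "mono L" "\<And>k. 0 < L k" and lim: "filterlim L at_top sequentially"
    using assms by (auto simp: proper_Lambda_sequence_def Lambda_sequence_def)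
  have V: "Lambda_variation (tail_seq m L) ?g \<le> ennreal (?K / L m)" for m
  proof -
    have "Lambda_variation (tail_seq m L) ?g = Lambda_variation (tail_seq m L) (broken_line n c)"
      by (rule Lambda_variation_cong) simp
    also have "\<dots> \<le> ennreal (?K / tail_seq m L 0)"
      using L by (intro Lambda_variation_broken_line_le) (auto simp: tail_seq_def mono_def)
    finally show ?thesis by (simp add: tail_seq_def)
  qed
  have "((\<lambda>m. ?K / L m) \<longlongrightarrow> 0) sequentially"
    by (intro tendsto_divide_0[OF tendsto_const] filterlim_at_top_imp_at_infinity lim)
  then have "(\<lambda>m. ennreal (?K / L m)) \<longlonglongrightarrow> 0"
    by (auto dest: tendsto_ennrealI)
  then have "(\<lambda>m. Lambda_variation (tail_seq m L) ?g) \<longlonglongrightarrow> 0"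
    by (rule tendsto_sandwich[rotated 3, where f = "\<lambda>_. 0"]) (use V in auto)
  moreover have "Lambda_variation L ?g < \<infinity>"
    using order.strict_trans1[OF V[of 0] ennreal_less_top] by (simp add: tail_seq_def)
  moreover have "continuous_on {0..1} ?g"
    by (rule continuous_on_cong[THEN iffD2, OF refl _ continuous_on_broken_line]) simp
  ultimately show ?thesis
    by (simp add: C_Lambda_BV_c_def continuous_in_Lambda_variation_def Lambda_BV_def)
qed

section \<open>Interpolation as averaged rounding\<close>

abbreviation unit_uniform :: "real measure" where
  "unit_uniform \<equiv> restrict_space lborel {0..<1}"

lemma prob_space_unit_uniform: "prob_space unit_uniform"
  by (rule prob_spaceI) (simp add: emeasure_restrict_space space_restrict_space)

lemma measure_unit_uniform: "measure unit_uniform {0..<1} = 1"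
  by (simp add: measure_restrict_space)

text \<open>
  For \<open>u\<close> in \<open>[0,1)\<close>, \<open>\<lfloor>y + u\<rfloor> = j\<close> holds exactly when \<open>u\<close> lies in \<open>[j - y, j + 1 - y)\<close>. The
  part of that interval inside \<open>[0,1)\<close> has length \<open>max 0 (1 - \<bar>y - j\<bar>)\<close>: the hat function at \<open>j\<close>
  is the probability of rounding to \<open>j\<close>.
\<close>

lemma has_integral_random_rounding:
  assumes x: "x \<in> {0..1}"
  shows "has_bochner_integral unit_uniform (\<lambda>u. c (nat \<lfloor>real n * x + u\<rfloor>)) (broken_line n c x)"
proof -
  let ?y = "real n * x"
  let ?B = "\<lambda>j. {real j - ?y..<real j + 1 - ?y} \<inter> {0..<1}"
  have y: "0 \<le> ?y" "?y \<le> n" using x by (auto simp: mult_left_le)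
  have B: "?B j = {max (real j - ?y) 0..<min (real j + 1 - ?y) 1}" for j by auto
  have "measure unit_uniform (?B j) = measure lborel (?B j)" for j
    by (rule measure_restrict_space) auto
  also have "measure lborel (?B j) = max 0 (1 - \<bar>?y - real j\<bar>)" for j
    proof (cases "max (real j - ?y) 0 \<le> min (real j + 1 - ?y) 1")
    case True
    then have "measure lborel (?B j) = min (real j + 1 - ?y) 1 - max (real j - ?y) 0"
      unfolding B by (rule measure_lborel_Ico)
    with True show ?thesis by linarith
  next
    case False
    then have "?B j = {}" unfolding B by (simp only: atLeastLessThan_empty_iff)
    then have "measure lborel (?B j) = 0" by (metis measure_empty)
    with False show ?thesis by linarith
  qed
  finally have mB: "measure unit_uniform (?B j) = max 0 (1 - \<bar>?y - real j\<bar>)" for j .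
  interpret prob_space unit_uniform by (rule prob_space_unit_uniform)
  have "has_bochner_integral unit_uniform (\<lambda>u. \<Sum>j\<le>n. c j * indicator (?B j) u)
          (\<Sum>j\<le>n. c j * measure unit_uniform (?B j))"
    by (intro has_bochner_integral_sum has_bochner_integral_mult_right
          has_bochner_integral_real_indicator) (auto simp: sets_restrict_space emeasure_eq_measure)
  moreover have "(\<Sum>j\<le>n. c j * indicator (?B j) u) = c (nat \<lfloor>?y + u\<rfloor>)"
    if "u \<in> space unit_uniform" for u
  proof -
    have u: "0 \<le> u" "u < 1" using that by (auto simp: space_restrict_space)
    have ind: "indicator (?B j) u = (if j = nat \<lfloor>?y + u\<rfloor> then 1 else 0 :: real)" for j
    proof -
      have "u \<in> ?B j \<longleftrightarrow> \<lfloor>?y + u\<rfloor> = int j"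
        using u by (auto simp: floor_eq_iff)
      also have "\<dots> \<longleftrightarrow> j = nat \<lfloor>?y + u\<rfloor>" using u y by auto
      finally show ?thesis by (simp add: indicator_def)
    qed
    have "(\<Sum>j\<le>n. c j * indicator (?B j) u) = (\<Sum>j\<le>n. if j = nat \<lfloor>?y + u\<rfloor> then c j else 0)"
      unfolding ind by (intro sum.cong) auto
    \<comment> \<open>At \<open>x = 1\<close> this needs \<open>u < 1\<close>; otherwise the rounding would leave the grid.\<close>
    moreover have "nat \<lfloor>?y + u\<rfloor> \<le> n" using u y by linarith
    ultimately show ?thesis by simp
  qed
  ultimately show ?thesis
    unfolding broken_line_def mB by (subst has_bochner_integral_cong) auto
qed

definition round_to_grid :: "nat \<Rightarrow> real \<Rightarrow> real \<Rightarrow> real" where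
  "round_to_grid n u x = real (nat \<lfloor>real n * x + u\<rfloor>) / real n"

definition interpolant :: "nat \<Rightarrow> (real \<Rightarrow> real) \<Rightarrow> real \<Rightarrow> real" where
  "interpolant n f = broken_line n (\<lambda>j. f (real j / real n))"

lemma interpolant_eq_integral:
  assumes "x \<in> {0..1}"
  shows "has_bochner_integral unit_uniform (\<lambda>u. f (round_to_grid n u x)) (interpolant n f x)"
  using has_integral_random_rounding[OF assms, of "\<lambda>j. f (real j / real n)" n]
  by (simp add: interpolant_def round_to_grid_def)

lemma round_to_grid_in_unit:
  assumes "0 < n" "u \<in> {0..<1}" "x \<in> {0..1}"
  shows "round_to_grid n u x \<in> {0..1}"
proof -
  have "real n * x \<le> real n" using assms by (simp add: mult_left_le)
  moreover have "u < 1" using assms by simp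
  ultimately have "nat \<lfloor>real n * x + u\<rfloor> \<le> n" by linarith
  then show ?thesis using assms(1) by (simp add: round_to_grid_def)
qed

lemma mono_round_to_grid: "mono (round_to_grid n u)"
  by (auto intro!: monoI divide_right_mono nat_mono floor_mono mult_left_mono
           simp: round_to_grid_def)

lemma round_to_grid_close:
  assumes "0 < n" "u \<in> {0..<1}" "x \<in> {0..1}"
  shows "\<bar>round_to_grid n u x - x\<bar> \<le> 1 / real n"
proof -
  have "0 \<le> real n * x" "0 \<le> u" "u < 1" using assms by auto
  then have "\<bar>real (nat \<lfloor>real n * x + u\<rfloor>) - real n * x\<bar> \<le> 1" by linarith
  then have "\<bar>real (nat \<lfloor>real n * x + u\<rfloor>) - real n * x\<bar> / real n \<le> 1 / real n"
    by (intro divide_right_mono) auto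
  moreover have "round_to_grid n u x - x = (real (nat \<lfloor>real n * x + u\<rfloor>) - real n * x) / real n"
    using assms(1) by (simp add: round_to_grid_def diff_divide_distrib)
  ultimately show ?thesis by simp
qed

text \<open>
  An increment of the interpolant is the mean over \<open>u\<close> of the increments of \<open>f\<close> along the rounded
  interval. As rounding with a fixed \<open>u\<close> is monotone, the rounded intervals still form an
  admissible sequence, in the same order and hence with the same weights; so each variation sum
  of the interpolant is dominated by a mean of variation sums of \<open>f\<close>.
\<close>

lemma Lambda_variation_interpolant_le:
  assumes L: "\<And>k. 0 < L k" and n: "0 < n"
  shows "Lambda_variation L (interpolant n f) \<le> Lambda_variation L f"
proof (cases "Lambda_variation L f = \<infinity>")
  case False
  define v where "v = enn2real (Lambda_variation L f)"
  have v: "Lambda_variation L f = ennreal v" and v0: "0 \<le> v"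
    using False by (auto simp: v_def less_top)
  interpret prob_space unit_uniform by (rule prob_space_unit_uniform)
  have "var_sum L (interpolant n f) Is \<le> v" if Is: "Is \<in> interval_seqs" for Is
  proof -
    let ?a = "\<lambda>k. fst (Is ! k)" and ?b = "\<lambda>k. snd (Is ! k)"
    let ?r = "round_to_grid n"
    let ?D = "\<lambda>k u. f (?r u (?b k)) - f (?r u (?a k))"
    have D: "has_bochner_integral unit_uniform (?D k) (interpolant n f (?b k) - interpolant n f (?a k))"
      if "k < length Is" for k
      using interval_seqs_nth[OF Is that]
      by (intro has_bochner_integral_diff interpolant_eq_integral)
    have intD: "integrable unit_uniform (\<lambda>u. \<bar>?D k u\<bar> / L k)" if "k < length Is" for k
      using D[OF that] by (auto simp: has_bochner_integral_iff)
    have "var_sum L (interpolant n f) Is \<le> (\<Sum>k<length Is. LINT u|unit_uniform. \<bar>?D k u\<bar> / L k)"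
      unfolding var_sum_def
    proof (rule sum_mono)
      fix k assume "k \<in> {..<length Is}"
      then have "interpolant n f (?b k) - interpolant n f (?a k) = (LINT u|unit_uniform. ?D k u)"
        using D by (simp add: has_bochner_integral_iff)
      also have "\<bar>\<dots>\<bar> \<le> (LINT u|unit_uniform. \<bar>?D k u\<bar>)"
        by (rule integral_abs_bound)
      finally show "\<bar>interpolant n f (?b k) - interpolant n f (?a k)\<bar> / L k
          \<le> (LINT u|unit_uniform. \<bar>?D k u\<bar> / L k)"
        using L[of k] by (simp add: divide_right_mono)
    qed
    also have "\<dots> = (LINT u|unit_uniform. (\<Sum>k<length Is. \<bar>?D k u\<bar> / L k))"
      by (intro Bochner_Integration.integral_sum[symmetric] intD) simp
    also have "\<dots> \<le> (LINT u|unit_uniform. v)"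
    proof (rule integral_mono)
      fix u assume "u \<in> space unit_uniform"
      then have u: "u \<in> {0..<1}" by (simp add: space_restrict_space)
      have "map (map_prod (?r u) (?r u)) Is \<in> interval_seqs"
        using round_to_grid_in_unit[OF n u] mono_round_to_grid[of n u]
        by (intro interval_seqs_mono_image[OF Is]) (auto simp: mono_on_def mono_def)
      then have "ennreal (var_sum L f (map (map_prod (?r u) (?r u)) Is)) \<le> ennreal v"
        unfolding v[symmetric] by (rule Lambda_variation_upper)
      then have "var_sum L f (map (map_prod (?r u) (?r u)) Is) \<le> v"
        using v0 by simp
      also have "var_sum L f (map (map_prod (?r u) (?r u)) Is) = (\<Sum>k<length Is. \<bar>?D k u\<bar> / L k)"
        by (simp add: var_sum_def)
      finally show "(\<Sum>k<length Is. \<bar>?D k u\<bar> / L k) \<le> v" .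
    qed (use intD in auto)
    finally show ?thesis by (simp add: measure_unit_uniform)
  qed
  then show ?thesis
    unfolding v unfolding Lambda_variation_def by (intro SUP_least ennreal_leI)
qed simp

text \<open>Rounding moves a point by at most \<open>1 / n\<close>, so uniform continuity bounds the integrand.\<close>

lemma interpolant_uniformly_close:
  assumes f: "continuous_on {0..1} f" and \<eta>: "0 < \<eta>"
  obtains n where "0 < n" "\<And>x. x \<in> {0..1} \<Longrightarrow> \<bar>f x - interpolant n f x\<bar> \<le> \<eta>"
proof -
  have "uniformly_continuous_on {0..1} f"
    using f by (simp add: compact_uniformly_continuous)
  then have "\<exists>d>0. \<forall>x\<in>{0..1}. \<forall>y\<in>{0..1}. \<bar>y - x\<bar> < d \<longrightarrow> \<bar>f y - f x\<bar> < \<eta>"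
    using \<eta> unfolding uniformly_continuous_on_def dist_real_def by blast
  then obtain d where d: "0 < d"
    "\<And>x y. x \<in> {0..1} \<Longrightarrow> y \<in> {0..1} \<Longrightarrow> \<bar>y - x\<bar> < d \<Longrightarrow> \<bar>f y - f x\<bar> < \<eta>"
    by auto
  obtain k where "1 / real (Suc k) < d"
    using d(1) by (rule nat_approx_posE)
  then obtain n where n: "0 < n" "1 / real n < d"
    by blast
  interpret prob_space unit_uniform by (rule prob_space_unit_uniform)
  have "\<bar>f x - interpolant n f x\<bar> \<le> \<eta>" if x: "x \<in> {0..1}" for x
  proof -
    have I: "has_bochner_integral unit_uniform (\<lambda>u. f x - f (round_to_grid n u x))
        (f x - interpolant n f x)"
      using has_bochner_integral_diff[OF _ interpolant_eq_integral[OF x, of f n],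
          where f = "\<lambda>_. f x" and x = "f x"]
      by (simp add: has_bochner_integral_iff measure_unit_uniform)
    then have "\<bar>f x - interpolant n f x\<bar> \<le> (LINT u|unit_uniform. \<bar>f x - f (round_to_grid n u x)\<bar>)"
      using integral_abs_bound[of unit_uniform "\<lambda>u. f x - f (round_to_grid n u x)"]
      by (simp add: has_bochner_integral_iff)
    also have "\<dots> \<le> (LINT u|unit_uniform. \<eta>)"
    proof (rule integral_mono)
      fix u assume "u \<in> space unit_uniform"
      then have u: "u \<in> {0..<1}" by (simp add: space_restrict_space)
      have "\<bar>x - round_to_grid n u x\<bar> < d"
        using round_to_grid_close[OF n(1) u x] n(2) by linarith
      then show "\<bar>f x - f (round_to_grid n u x)\<bar> \<le> \<eta>"
        using d(2)[OF round_to_grid_in_unit[OF n(1) u x] x] by simp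
    qed (use I in \<open>auto simp: has_bochner_integral_iff\<close>)
    finally show ?thesis by (simp add: measure_unit_uniform)
  qed
  with n(1) show ?thesis by (rule that)
qed

section \<open>Density of the rational broken lines\<close>

text \<open>
  The order of choices matters: \<open>m\<close> depends on \<open>f\<close> only, because the tail variation of every
  interpolant is bounded by that of \<open>f\<close>; \<open>n\<close> is chosen afterwards, to beat the first \<open>m\<close> weights.
\<close>

lemma interpolants_dense:
  assumes L: "\<And>k. 0 < L k" and f: "f \<in> C_Lambda_BV_c L" and e: "0 < e"
  obtains n where "0 < n"
    "Lambda_variation L (\<lambda>x. f x - interpolant n f x) \<le> ennreal e"
    "\<bar>f 0 - interpolant n f 0\<bar> \<le> e"
proof -
  have cont: "continuous_on {0..1} f"
    and "(\<lambda>m. Lambda_variation (tail_seq m L) f) \<longlonglongrightarrow> 0"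
    using f by (auto simp: C_Lambda_BV_c_def continuous_in_Lambda_variation_def)
  then have "\<forall>\<^sub>F m in sequentially. Lambda_variation (tail_seq m L) f < ennreal (e / 3)"
    using e by (intro order_tendstoD) auto
  then obtain m where m: "Lambda_variation (tail_seq m L) f \<le> ennreal (e / 3)"
    by (auto simp: eventually_sequentially intro: less_imp_le)
  define S where "S = (\<Sum>k<m. 1 / L k)"
  have S: "0 \<le> S" unfolding S_def using L by (intro sum_nonneg) (auto simp: less_imp_le)
  \<comment> \<open>Makes \<open>2 * \<eta> * S\<close> at most \<open>e / 3\<close> and \<open>\<eta>\<close> at most \<open>e\<close>; the summand \<open>1\<close> covers \<open>S = 0\<close>.\<close>
  define \<eta> where "\<eta> = e / (6 * S + 1)"
  have \<eta>: "0 < \<eta>" "\<eta> \<le> e" "2 * \<eta> * S \<le> e / 3"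
    using e S by (auto simp: \<eta>_def field_simps)
  obtain n where n: "0 < n" "\<And>x. x \<in> {0..1} \<Longrightarrow> \<bar>f x - interpolant n f x\<bar> \<le> \<eta>"
    by (rule interpolant_uniformly_close[OF cont \<eta>(1)]) blast
  have L': "0 < tail_seq m L k" for k using L by (simp add: tail_seq_def)
  have "Lambda_variation (tail_seq m L) (\<lambda>x. f x - interpolant n f x)
      \<le> Lambda_variation (tail_seq m L) f + Lambda_variation (tail_seq m L) (interpolant n f)"
    by (rule Lambda_variation_le_add[OF L']) linarith
  also have "\<dots> \<le> ennreal (e / 3) + ennreal (e / 3)"
    by (intro add_mono m order_trans[OF Lambda_variation_interpolant_le[OF L' n(1)] m])
  finally have tail: "Lambda_variation (tail_seq m L) (\<lambda>x. f x - interpolant n f x)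
      \<le> ennreal (e / 3) + ennreal (e / 3)" .
  have "Lambda_variation L (\<lambda>x. f x - interpolant n f x)
      \<le> ennreal (2 * \<eta> * S) + Lambda_variation (tail_seq m L) (\<lambda>x. f x - interpolant n f x)"
    unfolding S_def by (rule Lambda_variation_le_sup_plus_tail[OF L n(2)])
  also have "\<dots> \<le> ennreal (e / 3) + (ennreal (e / 3) + ennreal (e / 3))"
    using \<eta>(3) tail by (intro add_mono ennreal_leI)
  also have "\<dots> = ennreal e"
    using e by (simp flip: ennreal_plus)
  finally have "Lambda_variation L (\<lambda>x. f x - interpolant n f x) \<le> ennreal e" .
  moreover have "\<bar>f 0 - interpolant n f 0\<bar> \<le> e"
    using n(2)[of 0] \<eta>(2) by simp
  ultimately show ?thesis by (rule that[OF n(1)])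
qed

text \<open>
  Indexing by lists of rationals makes the family visibly countable; only the first \<open>n + 1\<close>
  entries are intended as node values. The restriction makes the functions extensional.
\<close>

definition rational_broken_line :: "nat \<times> rat list \<Rightarrow> real \<Rightarrow> real" where
  "rational_broken_line = (\<lambda>(n, qs). restrict (broken_line n (\<lambda>j. of_rat (qs ! j))) {0..1})"

lemma rational_nodes_dense:
  fixes c :: "nat \<Rightarrow> real"
  assumes "0 < \<delta>"
  obtains qs :: "rat list" where "(\<Sum>j\<le>n. \<bar>c j - of_rat (qs ! j)\<bar>) \<le> \<delta>"
proof -
  have "\<exists>q. \<bar>c j - of_rat q\<bar> \<le> \<delta> / (n + 1)" for j
  proof -
    obtain q where "c j < of_rat q" "of_rat q < c j + \<delta> / (n + 1)"
      using of_rat_dense[of "c j" "c j + \<delta> / (n + 1)"] assms by auto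
    then show ?thesis by (intro exI[of _ q]) auto
  qed
  then obtain q where q: "\<And>j. \<bar>c j - of_rat (q j)\<bar> \<le> \<delta> / (n + 1)" by metis
  have "(\<Sum>j\<le>n. \<bar>c j - of_rat (map q [0..<Suc n] ! j)\<bar>) \<le> (\<Sum>j\<le>n. \<delta> / (n + 1))"
    using q by (intro sum_mono) (simp del: upt_Suc)
  also have "\<dots> = \<delta>" by (simp add: field_simps)
  finally show ?thesis by (rule that)
qed

text \<open>
  On the grid of a good interpolant the nodes are moved to rationals. Since the number of nodes is
  fixed by then, the crude bound \<open>n / L 0\<close> times the total displacement of the nodes suffices.
\<close>

lemma rational_broken_lines_dense:
  assumes L: "mono L" "\<And>k. 0 < L k" and f: "f \<in> C_Lambda_BV_c L" and r: "0 < r"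
  shows "\<exists>p. Lambda_dist L f (rational_broken_line p) < r"
proof -
  \<comment> \<open>Each of the two approximations costs \<open>e\<close> in variation and \<open>e\<close> at \<open>0\<close>, in total \<open>4 * e < r\<close>.\<close>
  define e where "e = r / 5"
  have e: "0 < e" using r by (simp add: e_def)
  obtain n where n: "0 < n" "Lambda_variation L (\<lambda>x. f x - interpolant n f x) \<le> ennreal e"
    "\<bar>f 0 - interpolant n f 0\<bar> \<le> e"
    using interpolants_dense[OF L(2) f e] by metis
  define \<delta> where "\<delta> = min e (e * L 0 / n)"
  have \<delta>: "0 < \<delta>" "\<delta> \<le> e" "real n * \<delta> / L 0 \<le> e"
    using e n(1) L(2)[of 0] by (auto simp: \<delta>_def min_def field_simps)
  obtain qs :: "rat list" where qs: "(\<Sum>j\<le>n. \<bar>f (real j / real n) - of_rat (qs ! j)\<bar>) \<le> \<delta>"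
    using rational_nodes_dense[OF \<delta>(1)] by metis
  define q where "q = broken_line n (\<lambda>j. of_rat (qs ! j))"
  let ?d = "\<lambda>j. f (real j / real n) - of_rat (qs ! j)"
  have diff: "interpolant n f x - q x = broken_line n ?d x" for x
    unfolding interpolant_def q_def by (rule broken_line_diff)
  have "Lambda_variation L (\<lambda>x. interpolant n f x - q x) \<le> ennreal (real n * (\<Sum>j\<le>n. \<bar>?d j\<bar>) / L 0)"
    unfolding diff by (rule Lambda_variation_broken_line_le[OF L])
  also have "\<dots> \<le> ennreal e"
  proof (rule ennreal_leI)
    have "real n * (\<Sum>j\<le>n. \<bar>?d j\<bar>) / L 0 \<le> real n * \<delta> / L 0"
      using qs L(2)[of 0] by (intro divide_right_mono mult_left_mono) auto
    with \<delta>(3) show "real n * (\<Sum>j\<le>n. \<bar>?d j\<bar>) / L 0 \<le> e" by linarith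
  qed
  finally have V2: "Lambda_variation L (\<lambda>x. interpolant n f x - q x) \<le> ennreal e" .
  have "Lambda_variation L (\<lambda>x. f x - rational_broken_line (n, qs) x) = Lambda_variation L (\<lambda>x. f x - q x)"
    by (rule Lambda_variation_cong) (simp add: rational_broken_line_def q_def)
  also have "\<dots> \<le> Lambda_variation L (\<lambda>x. f x - interpolant n f x)
      + Lambda_variation L (\<lambda>x. interpolant n f x - q x)"
    by (rule Lambda_variation_le_add[OF L(2)]) linarith
  also have "\<dots> \<le> ennreal e + ennreal e" by (intro add_mono n V2)
  also have "\<dots> = ennreal (2 * e)" using e by (simp flip: ennreal_plus)
  finally have "enn2real (Lambda_variation L (\<lambda>x. f x - rational_broken_line (n, qs) x)) \<le> 2 * e"
    using e by (intro enn2real_leI) auto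
  moreover have "\<bar>interpolant n f 0 - q 0\<bar> \<le> e"
    unfolding diff using abs_broken_line_le[of n ?d 0] qs \<delta>(2) by linarith
  then have "\<bar>f 0 - rational_broken_line (n, qs) 0\<bar> \<le> 2 * e"
    using n(3) by (simp add: rational_broken_line_def q_def)
  ultimately have "Lambda_dist L f (rational_broken_line (n, qs)) \<le> 4 * e"
    by (simp add: Lambda_dist_def Lambda_norm_def)
  then show ?thesis using e by (intro exI[of _ "(n, qs)"]) (simp add: e_def)
qed

theorem corollary2:
  fixes L :: "nat \<Rightarrow> real"
  assumes "proper_Lambda_sequence L"
  shows "separable_space (Lambda_topology L)"
proof -
  have L: "Lambda_sequence L" "mono L" "\<And>k. 0 < L k"
    using assms by (auto simp: proper_Lambda_sequence_def Lambda_sequence_def)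
  interpret Metric_space "C_Lambda_BV_c L" "Lambda_dist L"
    by (rule Metric_space_C_Lambda_BV_c[OF L(1)])
  have sub: "range rational_broken_line \<subseteq> C_Lambda_BV_c L"
    using restrict_broken_line_in_C_Lambda_BV_c[OF assms] by (auto simp: rational_broken_line_def)
  have "mtopology closure_of range rational_broken_line = C_Lambda_BV_c L"
  proof (intro equalityI subsetI)
    fix f assume f: "f \<in> C_Lambda_BV_c L"
    show "f \<in> mtopology closure_of range rational_broken_line"
      unfolding metric_closure_of
      using f sub rational_broken_lines_dense[OF L(2,3) f] by (auto simp: in_mball) blast
  qed (auto simp: metric_closure_of)
  then show ?thesis
    unfolding Lambda_topology_def separable_space_def
    using sub by (intro exI[of _ "range rational_broken_line"]) auto
qed

end
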